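(* There exist two-outcome observables $\mathsf{A}=\{\mathsf{A}_1,\mathsf{A}_2\}$ and $\mathsf{B}=\{\mathsf{B}_1,\mathsf{B}_2\}$ on $\mathbb{C}^3$ which do not commute, but such that $\mathsf{A}$ can be measured without disturbing $\mathsf{B}$.
   Context: Let $\mathcal{H}=\mathbb{C}^3$. An observable on $\mathcal{H}$ is a family $\mathsf{A}=\{\mathsf{A}_x\}_{x\in\Omega_{\mathsf{A}}}$ of positive operators on $\mathcal{H}$ with $\sum_x\mathsf{A}_x=\mathbb{1}$ (a discrete POVM). Observables $\mathsf{A},\mathsf{B}$ commute if $\mathsf{A}_x\mathsf{B}_y=\mathsf{B}_y\mathsf{A}_x$ for all $x\in\Omega_{\mathsf{A}},y\in\Omega_{\mathsf{B}}$. An instrument implementing $\mathsf{A}$ is a family $\mathcal{I}=\{\mathcal{I}_x\}_{x\in\Omega_{\mathsf{A}}}$ of completely positive linear maps on the operators on $\mathcal{H}$ such that $\mathcal{I}_x^*(\mathbb{1})=\mathsf{A}_x$ for all $x$; here the adjoint $\mathcal{I}_x^*$ is defined by $\mathrm{tr}[X\,\mathcal{I}_x(Y)]=\mathrm{tr}[\mathcal{I}_x^*(X)Y]$ for all $X,Y$. Put $\mathcal{I}_\Omega:=\sum_x\mathcal{I}_x$, with adjoint $\mathcal{I}_\Omega^*$. $\mathsf{A}$ can be measured without disturbing $\mathsf{B}$ if there is an instrument $\mathcal{I}$ implementing $\mathsf{A}$ with $\mathcal{I}_\Omega^*(\mathsf{B}_y)=\mathsf{B}_y$ for all $y\in\Omega_{\mathsf{B}}$.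 *)

theory Defs
  imports "HOL-Analysis.Analysis"
begin

text \<open>Operators on $\mathbb{C}^n$ are complex matrices over a finite index type.\<close>

type_synonym 'n op = "complex^'n^'n"

definition cinner :: "complex^'n \<Rightarrow> complex^'n \<Rightarrow> complex" where
  "cinner \<phi> \<psi> = (\<Sum>k\<in>UNIV. cnj (\<phi> $ k) * \<psi> $ k)"

definition positive_op :: "'n::finite op \<Rightarrow> bool" where
  "positive_op T \<longleftrightarrow> (\<forall>\<psi>. cinner \<psi> (T *v \<psi>) \<in> \<real>\<^sub>\<ge>\<^sub>0)"

text \<open>The library has no scalar multiplication of matrices by complex numbers.\<close>

definition op_scale :: "complex \<Rightarrow> 'n::finite op \<Rightarrow> 'n op" where
  "op_scale c T = (\<chi> i j. c * T $ i $ j)"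

abbreviation linear_map :: "('n::finite op \<Rightarrow> 'n op) \<Rightarrow> bool" where
  "linear_map \<equiv> Vector_Spaces.linear op_scale op_scale"

lemma vector_space_op_scale: "vector_space op_scale"
  by unfold_locales (simp_all add: op_scale_def vec_eq_iff algebra_simps)

text \<open>
  The operators \<open>X i j\<close> with \<open>i, j < m\<close> are the blocks of an operator on
  $\mathbb{C}^m \otimes \mathbb{C}^n$, and \<open>\<psi> i\<close> with \<open>i < m\<close> are the components of a vector of
  that space. Applying a map \<open>\<Phi>\<close> to every block is the action of $\mathrm{id}_m \otimes \Phi$.
\<close>

definition positive_block_op :: "nat \<Rightarrow> (nat \<Rightarrow> nat \<Rightarrow> 'n::finite op) \<Rightarrow> bool" where
  "positive_block_op m X \<longleftrightarrow>
     (\<forall>\<psi>. (\<Sum>i<m. \<Sum>j<m. cinner (\<psi> i) (X i j *v \<psi> j)) \<in> \<real>\<^sub>\<ge>\<^sub>0)"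

definition completely_positive :: "('n::finite op \<Rightarrow> 'n op) \<Rightarrow> bool" where
  "completely_positive \<Phi> \<longleftrightarrow>
     linear_map \<Phi> \<and>
     (\<forall>m X. positive_block_op m X \<longrightarrow> positive_block_op m (\<lambda>i j. \<Phi> (X i j)))"

text \<open>The description is proper for every linear \<open>\<Phi>\<close>; see \<open>ex1_dual_map\<close> below.\<close>

definition dual_map :: "('n::finite op \<Rightarrow> 'n op) \<Rightarrow> ('n op \<Rightarrow> 'n op)" where
  "dual_map \<Phi> = (THE \<Psi>. \<forall>X Y. trace (X ** \<Phi> Y) = trace (\<Psi> X ** Y))"

lemma trace_mult_unit:
  fixes A :: "'n::finite op"
  shows "trace (A ** (\<chi> a b. if a = j \<and> b = i then 1 else 0)) = A $ i $ j"
proof -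
  have "trace (A ** (\<chi> a b. if a = j \<and> b = i then 1 else 0)) =
        (\<Sum>p\<in>UNIV. \<Sum>q\<in>UNIV. if q = j then if p = i then A $ p $ q else 0 else 0)"
    unfolding trace_def matrix_matrix_mult_def vec_lambda_beta
    by (intro sum.cong refl) simp
  then show ?thesis by simp
qed

lemma ex1_dual_map:
  fixes \<Phi> :: "'n::finite op \<Rightarrow> 'n op"
  assumes "linear_map \<Phi>"
  shows "\<exists>!\<Psi>. \<forall>X Y. trace (X ** \<Phi> Y) = trace (\<Psi> X ** Y)"
proof -
  interpret L: Vector_Spaces.linear op_scale op_scale \<Phi> by (rule assms)
  define E :: "'n \<Rightarrow> 'n \<Rightarrow> 'n op"
    where "E = (\<lambda>j i. \<chi> a b. if a = j \<and> b = i then 1 else 0)"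
  define \<Psi> :: "'n op \<Rightarrow> 'n op" where "\<Psi> = (\<lambda>X. \<chi> i j. trace (X ** \<Phi> (E j i)))"
  have tr_sum: "trace (X ** sum F S) = (\<Sum>s\<in>S. trace (X ** F s))"
    if "finite S" for X :: "'n op" and F :: "'n \<Rightarrow> 'n op" and S
    using that by (induction S) (simp_all add: matrix_add_ldistrib trace_add trace_0[simplified])
  have tr_scale: "trace (X ** op_scale c Z) = c * trace (X ** Z)" for X Z :: "'n op" and c
    by (simp add: trace_def matrix_matrix_mult_def op_scale_def sum_distrib_left mult.left_commute)
  have "trace (X ** \<Phi> Y) = trace (\<Psi> X ** Y)" for X Y
  proof -
    have "Y = (\<Sum>i\<in>UNIV. \<Sum>j\<in>UNIV. op_scale (Y $ j $ i) (E j i))"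
    proof -
      have "(\<Sum>i\<in>UNIV. \<Sum>j\<in>UNIV. op_scale (Y $ j $ i) (E j i)) $ a $ b = Y $ a $ b" for a b
      proof -
        have "(\<Sum>i\<in>UNIV. \<Sum>j\<in>UNIV. op_scale (Y $ j $ i) (E j i)) $ a $ b =
              (\<Sum>i\<in>UNIV. \<Sum>j\<in>UNIV. if j = a then if i = b then Y $ j $ i else 0 else 0)"
          unfolding sum_component op_scale_def E_def vec_lambda_beta
          by (intro sum.cong refl) simp
        then show ?thesis by simp
      qed
      then show ?thesis by (simp add: vec_eq_iff)
    qed
    then have "\<Phi> Y = (\<Sum>i\<in>UNIV. \<Sum>j\<in>UNIV. op_scale (Y $ j $ i) (\<Phi> (E j i)))"
      by (metis (no_types, lifting) L.sum L.scale sum.cong)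
    then have "trace (X ** \<Phi> Y) =
        (\<Sum>i\<in>UNIV. \<Sum>j\<in>UNIV. Y $ j $ i * trace (X ** \<Phi> (E j i)))"
      by (simp add: tr_sum tr_scale)
    also have "\<dots> = (\<Sum>i\<in>UNIV. \<Sum>j\<in>UNIV. \<Psi> X $ i $ j * Y $ j $ i)"
      by (simp add: \<Psi>_def mult.commute)
    also have "\<dots> = trace (\<Psi> X ** Y)"
      by (simp add: trace_def matrix_matrix_mult_def)
    finally show ?thesis .
  qed
  moreover have "\<Psi>' = \<Psi>''"
    if "\<forall>X Y. trace (X ** \<Phi> Y) = trace (\<Psi>' X ** Y)"
      and "\<forall>X Y. trace (X ** \<Phi> Y) = trace (\<Psi>'' X ** Y)" for \<Psi>' \<Psi>''
  proof
    fix X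
    have "\<Psi>' X $ i $ j = \<Psi>'' X $ i $ j" for i j
      using that trace_mult_unit by metis
    then show "\<Psi>' X = \<Psi>'' X" by (simp add: vec_eq_iff)
  qed
  ultimately show ?thesis by blast
qed

definition observable :: "'x set \<Rightarrow> ('x \<Rightarrow> 'n::finite op) \<Rightarrow> bool" where
  "observable \<Omega> A \<longleftrightarrow> (\<forall>x\<in>\<Omega>. positive_op (A x)) \<and> (A has_sum mat 1) \<Omega>"

definition observables_commute ::
    "'x set \<Rightarrow> ('x \<Rightarrow> 'n::finite op) \<Rightarrow> 'y set \<Rightarrow> ('y \<Rightarrow> 'n op) \<Rightarrow> bool" where
  "observables_commute \<Omega>A A \<Omega>B B \<longleftrightarrow> (\<forall>x\<in>\<Omega>A. \<forall>y\<in>\<Omega>B. A x ** B y = B y ** A x)"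

definition implements ::
    "'x set \<Rightarrow> ('x \<Rightarrow> 'n::finite op \<Rightarrow> 'n op) \<Rightarrow> ('x \<Rightarrow> 'n op) \<Rightarrow> bool" where
  "implements \<Omega> \<I> A \<longleftrightarrow>
     (\<forall>x\<in>\<Omega>. completely_positive (\<I> x) \<and> dual_map (\<I> x) (mat 1) = A x)"

text \<open>\<open>\<Omega>\<close> may be infinite in the definitions above and below; for finite \<open>\<Omega>\<close>, \<open>has_sum\<close> and \<open>\<Sum>\<^sub>\<infinity>\<close>
  are the ordinary finite sums.\<close>

definition total_map ::
    "'x set \<Rightarrow> ('x \<Rightarrow> 'n::finite op \<Rightarrow> 'n op) \<Rightarrow> 'n op \<Rightarrow> 'n op" where
  "total_map \<Omega> \<I> T = (\<Sum>\<^sub>\<infinity>x\<in>\<Omega>. \<I> x T)"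

definition measurable_without_disturbing ::
    "'x set \<Rightarrow> ('x \<Rightarrow> 'n::finite op) \<Rightarrow> 'y set \<Rightarrow> ('y \<Rightarrow> 'n op) \<Rightarrow> bool" where
  "measurable_without_disturbing \<Omega>A A \<Omega>B B \<longleftrightarrow>
     (\<exists>\<I>. implements \<Omega>A \<I> A \<and> (\<forall>y\<in>\<Omega>B. dual_map (total_map \<Omega>A \<I>) (B y) = B y))"

end

theory Submission
  imports Defs
begin

text \<open>
  The total channel is of measure-and-prepare form, in the Heisenberg picture
  $X \mapsto X_{11} \mathsf{B}_1 + X_{22} \mathsf{B}_2$, with
  $\mathsf{B}_1 = \mathrm{diag}(1, 0, 9/25)$ and $\mathsf{B}_2 = \mathrm{diag}(0, 1, 16/25)$. Both are
  fixed, since their first two diagonal entries are 0 and 1. The channel has no faithful invariant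
  state, so its Kraus operators need not commute with its fixed points: decomposing $\mathsf{B}_1$ into
  non-diagonal rank-one operators $|g\rangle\langle g| + |h\rangle\langle h|$ and letting
  $\mathsf{A}_1 = |g\rangle\langle g|$ gives an observable that does not commute with $\mathsf{B}$.
\<close>

lemma matrix_add_rdistrib: "(B + C) ** A = B ** A + C ** A"
  by (simp add: matrix_matrix_mult_def vec_eq_iff distrib_right sum.distrib)

definition adjoint_op :: "'n::finite op \<Rightarrow> 'n op" where
  "adjoint_op K = (\<chi> i j. cnj (K $ j $ i))"

lemma cinner_matrix_vector_mult_right:
  "cinner \<phi> (K *v \<psi>) = cinner (adjoint_op K *v \<phi>) \<psi>"
proof -
  have "cinner \<phi> (K *v \<psi>) = (\<Sum>i\<in>UNIV. \<Sum>j\<in>UNIV. cnj (\<phi> $ i) * (K $ i $ j * \<psi> $ j))"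
    by (simp add: cinner_def matrix_vector_mult_def sum_distrib_left)
  also have "\<dots> = (\<Sum>j\<in>UNIV. \<Sum>i\<in>UNIV. cnj (\<phi> $ i) * (K $ i $ j * \<psi> $ j))"
    by (rule sum.swap)
  also have "\<dots> = cinner (adjoint_op K *v \<phi>) \<psi>"
    by (simp add: cinner_def matrix_vector_mult_def adjoint_op_def sum_distrib_left
        sum_distrib_right mult_ac)
  finally show ?thesis .
qed

lemma adjoint_op_adjoint_op [simp]: "adjoint_op (adjoint_op K) = K"
  by (simp add: adjoint_op_def vec_eq_iff)

lemma cinner_self_nonneg: "cinner \<psi> \<psi> \<in> \<real>\<^sub>\<ge>\<^sub>0"
  by (auto simp: cinner_def complex_nonneg_Reals_iff intro!: sum_nonneg sum.neutral)

lemma cinner_add_right: "cinner \<phi> (\<psi> + \<psi>') = cinner \<phi> \<psi> + cinner \<phi> \<psi>'"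
  by (simp add: cinner_def sum.distrib algebra_simps)

lemma positive_op_add: "positive_op S \<Longrightarrow> positive_op T \<Longrightarrow> positive_op (S + T)"
  by (simp add: positive_op_def matrix_vector_mult_add_rdistrib cinner_add_right)

text \<open>Only the outer factor \<open>adjoint_op K\<close> is moved to the left argument, which
  leaves the squared norm of \<open>K *v \<psi>\<close>.\<close>

lemma positive_op_adjoint_mult: "positive_op (adjoint_op K ** K)"
  by (simp add: positive_op_def cinner_matrix_vector_mult_right[where K = "adjoint_op K"] cinner_self_nonneg
      flip: matrix_vector_mul_assoc)

lemma completely_positive_add:
  assumes "completely_positive \<Phi>" "completely_positive \<Psi>"
  shows "completely_positive (\<lambda>Y. \<Phi> Y + \<Psi> Y)"
proof -
  interpret F: Vector_Spaces.linear op_scale op_scale \<Phi>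
    using assms(1) by (simp add: completely_positive_def)
  interpret G: Vector_Spaces.linear op_scale op_scale \<Psi>
    using assms(2) by (simp add: completely_positive_def)
  have "linear_map (\<lambda>Y. \<Phi> Y + \<Psi> Y)"
    by unfold_locales
      (simp_all add: F.add G.add F.scale G.scale
        vector_space.vector_space_assms(1)[OF vector_space_op_scale])
  with assms show ?thesis
    by (auto simp: completely_positive_def positive_block_op_def matrix_vector_mult_add_rdistrib
        cinner_add_right sum.distrib)
qed

definition kraus_map :: "'n::finite op \<Rightarrow> 'n op \<Rightarrow> 'n op" where
  "kraus_map K Y = K ** Y ** adjoint_op K"

lemma completely_positive_kraus_map: "completely_positive (kraus_map K)"
proof -
  interpret vector_space "op_scale :: complex \<Rightarrow> 'a op \<Rightarrow> 'a op" by (rule vector_space_op_scale)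
  have "kraus_map K (op_scale c Y) = op_scale c (kraus_map K Y)" for c Y
    by (simp add: kraus_map_def op_scale_def vec_eq_iff matrix_matrix_mult_def sum_distrib_left
        sum_distrib_right mult_ac)
  then have "linear_map (kraus_map K)"
    by unfold_locales (simp_all add: kraus_map_def matrix_add_ldistrib matrix_add_rdistrib)
  moreover have "positive_block_op m (\<lambda>i j. kraus_map K (X i j))" if "positive_block_op m X" for m X
    unfolding positive_block_op_def
  proof
    fix \<psi> :: "nat \<Rightarrow> complex^'a"
    \<comment> \<open>Moving the outer factor across turns the block form of the image at \<psi>
      into that of \<open>X\<close> at the vector with components
      \<open>adjoint_op K *v \<psi> i\<close>, where positivity is assumed.\<close>
    have "cinner (\<psi> i) (kraus_map K (X i j) *v \<psi> j) =
        cinner (adjoint_op K *v \<psi> i) (X i j *v (adjoint_op K *v \<psi> j))" for i j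
      by (simp add: kraus_map_def cinner_matrix_vector_mult_right flip: matrix_vector_mul_assoc)
    then show "(\<Sum>i<m. \<Sum>j<m. cinner (\<psi> i) (kraus_map K (X i j) *v \<psi> j)) \<in> \<real>\<^sub>\<ge>\<^sub>0"
      using that[unfolded positive_block_op_def, rule_format, of "\<lambda>i. adjoint_op K *v \<psi> i"] by simp
  qed
  ultimately show ?thesis by (simp add: completely_positive_def)
qed

text \<open>Cyclicity of the trace brings \<open>adjoint_op K\<close> to the front, so the
  Heisenberg dual of a Kraus map is again a Kraus map.\<close>

lemma trace_mult_kraus_map:
  "trace (X ** kraus_map K Y) = trace (kraus_map (adjoint_op K) X ** Y)"
  using trace_mul_sym[of "X ** K ** Y" "adjoint_op K"] by (simp add: kraus_map_def matrix_mul_assoc)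

text \<open>Since \<open>dual_map\<close> is a definite description, one map with the trace identity
  determines it once uniqueness is known; complete positivity supplies the linearity that
  \<open>ex1_dual_map\<close> asks for.\<close>

lemma dual_map_eqI:
  assumes "completely_positive \<Phi>" "\<And>X Y. trace (X ** \<Phi> Y) = trace (\<Psi> X ** Y)"
  shows "dual_map \<Phi> = \<Psi>"
proof -
  have "\<exists>!\<Psi>. \<forall>X Y. trace (X ** \<Phi> Y) = trace (\<Psi> X ** Y)"
    using assms(1) by (intro ex1_dual_map) (simp add: completely_positive_def)
  then show ?thesis
    unfolding dual_map_def by (rule the1_equality) (use assms(2) in blast)
qed

lemma dual_map_kraus_map: "dual_map (kraus_map K) = kraus_map (adjoint_op K)"
  by (intro dual_map_eqI completely_positive_kraus_map trace_mult_kraus_map)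

lemma dual_map_add:
  assumes "completely_positive \<Phi>" "completely_positive \<Psi>"
  shows "dual_map (\<lambda>Y. \<Phi> Y + \<Psi> Y) = (\<lambda>X. dual_map \<Phi> X + dual_map \<Psi> X)"
proof (rule dual_map_eqI)
  have dual: "trace (X ** \<Theta> Y) = trace (dual_map \<Theta> X ** Y)"
    if "completely_positive \<Theta>" for \<Theta> :: "'a op \<Rightarrow> 'a op" and X Y
    using theI'[OF ex1_dual_map, of \<Theta>] that unfolding dual_map_def completely_positive_def by blast
  show "trace (X ** (\<Phi> Y + \<Psi> Y)) = trace ((dual_map \<Phi> X + dual_map \<Psi> X) ** Y)" for X Y
    by (simp add: matrix_add_ldistrib matrix_add_rdistrib trace_add dual assms)
qed (intro completely_positive_add assms)

theorem mainTheorem5: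
  shows "\<exists>(A :: nat \<Rightarrow> complex^3^3) (B :: nat \<Rightarrow> complex^3^3).
    observable {1, 2} A \<and> observable {1, 2} B \<and>
    \<not> observables_commute {1, 2} A {1, 2} B \<and>
    measurable_without_disturbing {1, 2} A {1, 2} B"
proof -
  \<comment> \<open>The first rows of \<open>K\<close> and \<open>H\<close> are \<open>g\<close> and \<open>h\<close>.\<close>
  define K :: "complex^3^3" where "K = vector [vector [15/25, 0, 12/25], 0, 0]"
  define H :: "complex^3^3" where "H = vector [vector [20/25, 0, -9/25], 0, 0]"
  define L :: "complex^3^3" where "L = vector [0, vector [0, 1, 0], 0]"
  define M :: "complex^3^3" where "M = vector [0, vector [0, 0, 4/5], 0]"
  define e where "e = (\<lambda>K :: complex^3^3. adjoint_op K ** K)"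
  \<comment> \<open>\<open>A\<close> and \<open>B\<close> coarse-grain the same four effects
    differently: \<open>A\<close> isolates \<open>e K\<close>, which \<open>B\<close> groups with
    \<open>e H\<close>. The instrument \<open>\<I>\<close> groups the Kraus operators as
    \<open>A\<close> does.\<close>
  define A where "A = (\<lambda>x::nat. if x = 1 then e K else e H + e L + e M)"
  define B where "B = (\<lambda>y::nat. if y = 1 then e K + e H else e L + e M)"
  define \<I> where "\<I> = (\<lambda>x::nat. if x = 1 then kraus_map K
    else (\<lambda>Y. kraus_map H Y + kraus_map L Y + kraus_map M Y))"
  have mult_entry: "(X ** Y) $ i $ j =
      X $ i $ 1 * Y $ 1 $ j + X $ i $ 2 * Y $ 2 $ j + X $ i $ 3 * Y $ 3 $ j"
    for X Y :: "complex^3^3" and i j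
    by (simp add: matrix_matrix_mult_def sum_3)
  have adjoint_entry: "adjoint_op X $ i $ j = cnj (X $ j $ i)" for X :: "complex^3^3" and i j
    by (simp add: adjoint_op_def)
  note entries = vec_eq_iff forall_3 mult_entry adjoint_entry mat_def K_def H_def L_def M_def
  have pos: "positive_op (e T)" for T
    by (simp add: e_def positive_op_adjoint_mult)
  \<comment> \<open>The vectors g and h are the images of the orthonormal vectors (3/5, 0, 4/5) and
    (4/5, 0, -3/5) under diag(1, 0, 3/5), so \<open>e K + e H\<close> is its square diag(1, 0,
    9/25). The complement diag(0, 1, 16/25) is \<open>e L + e M\<close>.\<close>
  have sum_e: "e K + e H + e L + e M = mat 1"
    by (simp add: e_def entries)
  have A: "observable {1, 2} A"
    using sum_e by (auto simp: observable_def A_def pos positive_op_add add.assoc intro!: has_sum_finiteI)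
  have B: "observable {1, 2} B"
    using sum_e by (auto simp: observable_def B_def pos positive_op_add add.assoc intro!: has_sum_finiteI)
  \<comment> \<open>\<open>B 1\<close> is diagonal with first and third entries 1 and 9/25, so the
    two sides are 9/25 and 1 times the entry 36/125 of \<open>A 1\<close>.\<close>
  have "(A 1 ** B 1) $ 1 $ 3 \<noteq> (B 1 ** A 1) $ 1 $ 3"
    by (simp add: A_def B_def e_def entries)
  then have not_comm: "\<not> observables_commute {1, 2} A {1, 2} B"
    by (auto simp: observables_commute_def)
  note cp = completely_positive_add completely_positive_kraus_map
  note dual = dual_map_add dual_map_kraus_map cp
  have kraus_one: "kraus_map (adjoint_op T) (mat 1) = e T" for T
    by (simp add: kraus_map_def e_def)
  have impl: "implements {1, 2} \<I> A"
    by (simp add: implements_def \<I>_def A_def dual kraus_one)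
  have total: "total_map {1, 2} \<I> =
      (\<lambda>Y. kraus_map K Y + (kraus_map H Y + kraus_map L Y + kraus_map M Y))"
    by (simp add: total_map_def \<I>_def fun_eq_iff)
  have dual_total: "dual_map (total_map {1, 2} \<I>) = (\<lambda>X. kraus_map (adjoint_op K) X +
      (kraus_map (adjoint_op H) X + kraus_map (adjoint_op L) X + kraus_map (adjoint_op M) X))"
    unfolding total by (simp add: dual)
  have "dual_map (total_map {1, 2} \<I>) (B y) = B y" if "y \<in> {1, 2}" for y
  proof -
    \<comment> \<open>\<open>K\<close> and \<open>H\<close> map into the span of the first basis
      vector, \<open>L\<close> and \<open>M\<close> into that of the second, so each dual map sees a
      single diagonal entry of \<open>X\<close>.\<close>
    have "kraus_map (adjoint_op K) X = op_scale (X $ 1 $ 1) (e K)"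
      "kraus_map (adjoint_op H) X = op_scale (X $ 1 $ 1) (e H)"
      "kraus_map (adjoint_op L) X = op_scale (X $ 2 $ 2) (e L)"
      "kraus_map (adjoint_op M) X = op_scale (X $ 2 $ 2) (e M)" for X
      by (simp_all add: kraus_map_def e_def op_scale_def entries)
    moreover have "B 1 $ 1 $ 1 = 1" "B 1 $ 2 $ 2 = 0" "B 2 $ 1 $ 1 = 0" "B 2 $ 2 $ 2 = 1"
      by (simp_all add: B_def e_def entries)
    moreover have "op_scale 1 T = T" "op_scale 0 T = 0" for T :: "complex^3^3"
      by (simp_all add: op_scale_def vec_eq_iff)
    ultimately have "dual_map (total_map {1, 2} \<I>) (B 1) = e K + e H"
      "dual_map (total_map {1, 2} \<I>) (B 2) = e L + e M"
      unfolding dual_total by simp_all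
    with that show ?thesis by (auto simp: B_def)
  qed
  with impl have "measurable_without_disturbing {1, 2} A {1, 2} B"
    by (auto simp: measurable_without_disturbing_def)
  with A B not_comm show ?thesis by blast
qed

end
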